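(* Let $0\le k<1$ and $M\ge 0$ with $k+M<1$, let $f=h+\overline{g}\in\mathcal{H}^0_{k,M}$, and suppose that for some $C>0$ we have $|f(z)|\le C$ for all $z\in\mathbb{D}$. Then $f$ is univalent in the disk $\mathbb{D}_{r_C}$ with $$r_C=\frac{3\pi(1-k-M)}{256\,C}.$$ Moreover, $f(\mathbb{D}_{r_C})$ contains the disk centered at $0$ of radius $$R_C=\frac{3\pi(1-k-M)^2}{512\,C},$$ that is, $\{w\in\mathbb{C}:|w|<R_C\}\subset f(\mathbb{D}_{r_C})$.
   Context: $\mathbb{D}=\{z\in\mathbb{C}:|z|<1\}$ and $\mathbb{D}_r=\{z\in\mathbb{C}:|z|<r\}$. For an analytic function $\varphi$ in $\mathbb{D}$, $\|\varphi\|_\infty=\sup_{z\in\mathbb{D}}|\varphi(z)|$. Univalent means injective. Class $\mathcal{H}_{k,M}$ ($0\le k<1$, $M\ge 0$): the harmonic mappings $f=h+\overline{g}$ in $\mathbb{D}$ such that (1) $h$ and $g$ are analytic in $\mathbb{D}$; (2) $g(0)=0$; (3) there exist analytic functions $\omega,\psi$ in $\mathbb{D}$ such that $g'(z)=\omega(z)h'(z)+\psi(z)$ for all $z\in\mathbb{D}$; (4) $\|\omega\|_\infty\le k$ and $\|\psi\|_\infty\le M$; (5) $f$ is sense-preserving, i.e. $|g'(z)|<|h'(z)|$ for all $z\in\mathbb{D}$. Class $\mathcal{H}^0_{k,M}$: those $f=h+\overline{g}\in\mathcal{H}_{k,M}$ satisfying $f(0)=0$, $h'(0)=1$ and $g(0)=0$.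 *)

theory Defs
  imports "HOL-Complex_Analysis.Complex_Analysis"
begin

abbreviation unit_disk :: "complex set" (\<open>\<D>\<close>)
  where "\<D> \<equiv> ball 0 1"

text \<open>Valued in the extended reals, so that the norm of an unbounded function is \<open>\<infinity>\<close>
  rather than an unspecified real supremum.\<close>

definition sup_norm :: "(complex \<Rightarrow> complex) \<Rightarrow> ereal"
  where "sup_norm \<phi> = (SUP z\<in>\<D>. ereal (cmod (\<phi> z)))"

text \<open>\<open>harmonic_H k M f h g\<close> says that \<open>f = h + cnj g\<close> on the unit disk is a member of the class
  $\mathcal{H}_{k,M}$. The decomposition is carried along as an argument because further
  normalisations refer to it; it is determined on the disk by \<open>f\<close> and \<open>g 0 = 0\<close>.
  Values outside the disk are irrelevant.\<close>

definition harmonic_H ::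
  "real \<Rightarrow> real \<Rightarrow> (complex \<Rightarrow> complex) \<Rightarrow> (complex \<Rightarrow> complex) \<Rightarrow> (complex \<Rightarrow> complex) \<Rightarrow> bool"
  where "harmonic_H k M f h g \<longleftrightarrow>
    (\<forall>z\<in>\<D>. f z = h z + cnj (g z)) \<and>
    h analytic_on \<D> \<and> g analytic_on \<D> \<and>
    g 0 = 0 \<and>
    (\<exists>\<omega> \<psi>. \<omega> analytic_on \<D> \<and> \<psi> analytic_on \<D> \<and>
       (\<forall>z\<in>\<D>. deriv g z = \<omega> z * deriv h z + \<psi> z) \<and>
       sup_norm \<omega> \<le> ereal k \<and> sup_norm \<psi> \<le> ereal M) \<and>
    (\<forall>z\<in>\<D>. cmod (deriv g z) < cmod (deriv h z))"

definition harmonic_H0 ::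
  "real \<Rightarrow> real \<Rightarrow> (complex \<Rightarrow> complex) \<Rightarrow> (complex \<Rightarrow> complex) \<Rightarrow> (complex \<Rightarrow> complex) \<Rightarrow> bool"
  where "harmonic_H0 k M f h g \<longleftrightarrow>
    harmonic_H k M f h g \<and> f 0 = 0 \<and> deriv h 0 = 1 \<and> g 0 = 0"

end

theory Submission
  imports Defs
begin

text \<open>
  For a unimodular \<open>c\<close>, the real part of \<open>c f\<close> is that of the analytic function
  \<open>P = c h + cnj c g\<close>. So \<open>P\<close> maps the disk into the half-plane \<open>Re w \<le> C\<close>, and Schwarz's lemma
  followed by Cauchy's estimate gives \<open>cmod P'' \<le> 24 C\<close> on the disk of radius \<open>1 / 10\<close>.
  Choosing \<open>c\<close> according to the direction of a given difference turns this into a bound, independent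
  of \<open>c\<close>, for the deviation of \<open>f\<close> from its linear part, which expands distances by at least
  \<open>1 - k - M\<close>. Injectivity follows, and so does a lower bound for \<open>f\<close> on the bounding circle,
  hence the covering statement by invariance of domain.
\<close>

text \<open>The Moebius map \<open>w / (2 * C - w)\<close> fixes 0 and takes the half-plane
  \<open>Re w < C\<close> onto the unit disk, so Schwarz's lemma applies to its composition
  \<open>Q\<close> with \<open>P\<close>. Undoing the map in both conclusions gives the growth bound
  and the derivative bound.\<close>

lemma half_plane_Schwarz_strict:
  fixes P :: "complex \<Rightarrow> complex"
  assumes hol: "P holomorphic_on ball 0 1" and P0: "P 0 = 0" and C: "C > 0"
    and Re: "\<And>z. cmod z < 1 \<Longrightarrow> Re (P z) < C"
  shows "cmod z < 1 \<Longrightarrow> cmod (P z) * (1 - cmod z) \<le> 2 * C * cmod z"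
    and "cmod (deriv P 0) \<le> 2 * C"
proof -
  have less: "cmod (P z) < cmod (2 * C - P z)" if "cmod z < 1" for z
  proof -
    \<comment> \<open>The identity behind this is |2C - P|^2 - |P|^2 = 4C (C - Re P).\<close>
    have "0 < C * (C - Re (P z))"
      using Re[OF that] C by simp
    then have "(cmod (P z))\<^sup>2 < (cmod (2 * C - P z))\<^sup>2"
      unfolding cmod_power2 by (simp add: power2_eq_square algebra_simps)
    then show ?thesis
      by (simp add: power_less_imp_less_base)
  qed
  have nz: "2 * C - P z \<noteq> 0" if "cmod z < 1" for z
    using less[OF that] by auto
  define Q where "Q z = P z / (2 * C - P z)" for z
  have Qhol: "Q holomorphic_on ball 0 1"
    unfolding Q_def using hol nz by (auto intro!: holomorphic_intros)
  have Q0: "Q 0 = 0" by (simp add: Q_def P0)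
  have Q1: "cmod (Q z) < 1" if "cmod z < 1" for z
    using less[OF that] nz[OF that] by (simp add: Q_def norm_divide divide_simps)
  note S = Schwarz_Lemma[OF Qhol Q0 Q1]
  show "cmod (P z) * (1 - cmod z) \<le> 2 * C * cmod z" if z: "cmod z < 1"
  proof -
    have "cmod (P z) = cmod (Q z) * cmod (2 * C - P z)"
      using nz[OF z] by (simp add: Q_def norm_divide)
    also have "\<dots> \<le> cmod z * (2 * C + cmod (P z))"
    proof (rule mult_mono)
      show "cmod (2 * C - P z) \<le> 2 * C + cmod (P z)"
        using norm_triangle_ineq4[of "2 * complex_of_real C" "P z"] C by (simp add: norm_mult)
    qed (use S(1)[OF _ z] in auto)
    finally show ?thesis by (simp add: algebra_simps)
  qed
  have dP: "(P has_field_derivative deriv P 0) (at 0)"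
    using hol by (intro holomorphic_derivI[of _ "ball 0 1"]) auto
  have "(Q has_field_derivative deriv P 0 / (2 * C)) (at 0)"
    unfolding Q_def
    by (rule derivative_eq_intros dP refl | use C P0 in \<open>simp add: field_simps\<close>)+
  then have "deriv Q 0 = deriv P 0 / (2 * C)"
    by (rule DERIV_imp_deriv)
  moreover have "cmod (deriv Q 0) \<le> 1"
    using S(2)[of 0] by simp
  ultimately show "cmod (deriv P 0) \<le> 2 * C"
    using C by (simp add: norm_divide norm_mult)
qed

text \<open>The strict version holds for every bound \<open>D > C\<close>; letting \<open>D\<close>
  decrease to \<open>C\<close> covers \<open>Re (P z) \<le> C\<close>, which is what
  \<open>cmod (f z) \<le> C\<close> provides.\<close>

lemma half_plane_Schwarz:
  fixes P :: "complex \<Rightarrow> complex"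
  assumes hol: "P holomorphic_on ball 0 1" and P0: "P 0 = 0" and C: "C > 0"
    and Re: "\<And>z. cmod z < 1 \<Longrightarrow> Re (P z) \<le> C"
  shows "cmod z < 1 \<Longrightarrow> cmod (P z) * (1 - cmod z) \<le> 2 * C * cmod z"
    and "cmod (deriv P 0) \<le> 2 * C"
proof -
  have lt: "0 < D" "\<And>z. cmod z < 1 \<Longrightarrow> Re (P z) < D" if "C < D" for D
    using that C Re by force+
  note strict = half_plane_Schwarz_strict[OF hol P0 lt]
  show "cmod (P z) * (1 - cmod z) \<le> 2 * C * cmod z" if z: "cmod z < 1"
  proof (cases "z = 0")
    case False
    have "cmod (P z) * (1 - cmod z) / (2 * cmod z) \<le> C"
    proof (rule dense_ge)
      fix D assume "C < D"
      then show "cmod (P z) * (1 - cmod z) / (2 * cmod z) \<le> D"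
        using strict(1)[of D z] z False by (simp add: field_simps)
    qed
    then show ?thesis using False by (simp add: field_simps)
  qed (simp add: P0)
  have "cmod (deriv P 0) / 2 \<le> C"
  proof (rule dense_ge)
    fix D assume "C < D"
    then show "cmod (deriv P 0) / 2 \<le> D"
      using strict(2)[of D] by simp
  qed
  then show "cmod (deriv P 0) \<le> 2 * C" by simp
qed

text \<open>The circle of radius 1/2 about \<open>z\<close> stays in
  \<open>cmod w \<le> 3 / 5\<close>, where the growth bound gives
  \<open>cmod (P w) \<le> 3 * C\<close>. Cauchy's estimate then yields 2! * 3C / (1/2)^2 =
  24C.\<close>

lemma half_plane_deriv2_bound:
  fixes P :: "complex \<Rightarrow> complex"
  assumes hol: "P holomorphic_on ball 0 1" and P0: "P 0 = 0" and C: "C > 0"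
    and Re: "\<And>z. cmod z < 1 \<Longrightarrow> Re (P z) \<le> C" and z: "cmod z \<le> 1 / 10"
  shows "cmod (deriv (deriv P) z) \<le> 24 * C"
proof -
  have w: "cmod w \<le> 3 / 5" if "cmod (z - w) \<le> 1 / 2" for w
    using z that norm_triangle_ineq4[of z "z - w"] by simp
  then have sub: "cball z (1 / 2) \<subseteq> ball 0 1"
    by (fastforce simp: dist_norm)
  have bound: "cmod (P w) \<le> 3 * C" if "cmod (z - w) = 1 / 2" for w
  proof -
    have w': "cmod w \<le> 3 / 5" using w that by simp
    have "cmod (P w) * (2 / 5) \<le> cmod (P w) * (1 - cmod w)"
      using w' by (intro mult_left_mono) auto
    also have "\<dots> \<le> 2 * C * cmod w"
      using half_plane_Schwarz(1)[OF hol P0 C Re] w' by simp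
    also have "\<dots> \<le> 2 * C * (3 / 5)"
      using w' C by (intro mult_left_mono) auto
    finally show ?thesis by simp
  qed
  have "cmod ((deriv ^^ 2) P z) \<le> fact 2 * (3 * C) / (1 / 2) ^ 2"
  proof (rule Cauchy_inequality)
    show "P holomorphic_on ball z (1 / 2)" 
      using holomorphic_on_subset[OF hol] sub ball_subset_cball by blast
    show "continuous_on (cball z (1 / 2)) P"
      using holomorphic_on_imp_continuous_on[OF hol] sub continuous_on_subset by blast
  qed (use bound in auto)
  then show ?thesis by (simp add: numeral_2_eq_2)
qed

text \<open>The derivative of \<open>K\<close> is P' - P'(0), which vanishes at 0 and is at most 24
  C |z| by the bound on P''. Its supremum on the disk gives the Lipschitz bound used for
  injectivity; integrating it along a radius gives the quadratic bound, with half the constant, used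
  for covering.\<close>

lemma half_plane_linear_deviation:
  fixes P :: "complex \<Rightarrow> complex"
  assumes hol: "P holomorphic_on ball 0 1" and P0: "P 0 = 0" and C: "C > 0"
    and Re: "\<And>z. cmod z < 1 \<Longrightarrow> Re (P z) \<le> C" and r: "r \<le> 1 / 10"
  defines "K \<equiv> \<lambda>z. P z - deriv P 0 * z"
  shows "cmod z \<le> r \<Longrightarrow> cmod w \<le> r \<Longrightarrow> cmod (K z - K w) \<le> 24 * C * r * cmod (z - w)"
    and "cmod z \<le> r \<Longrightarrow> cmod (K z) \<le> 12 * C * (cmod z)\<^sup>2"
proof -
  have dP: "(P has_field_derivative deriv P z) (at z)"
    and dP': "(deriv P has_field_derivative deriv (deriv P) z) (at z)" if "cmod z \<le> r" for z
    using that r holomorphic_derivI[OF hol, of z]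
      holomorphic_derivI[OF holomorphic_deriv[OF hol], of z] by auto
  have dK: "(K has_field_derivative deriv P z - deriv P 0) (at z)" if "cmod z \<le> r" for z
    unfolding K_def using dP[OF that] by (auto intro!: derivative_eq_intros)
  have K': "cmod (deriv P z - deriv P 0) \<le> 24 * C * cmod z" if z: "cmod z \<le> r" for z
  proof -
    have "0 \<le> r" using z norm_ge_zero order_trans by blast
    then show ?thesis
      using field_differentiable_bound[of "cball 0 r" "deriv P" "deriv (deriv P)" "24 * C" z 0]
        has_field_derivative_at_within[OF dP'] half_plane_deriv2_bound[OF hol P0 C Re] z r by simp
  qed
  show "cmod (K z - K w) \<le> 24 * C * r * cmod (z - w)" if z: "cmod z \<le> r" and w: "cmod w \<le> r"
  proof (rule field_differentiable_bound[of "cball 0 r" K "\<lambda>z. deriv P z - deriv P 0"])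
    fix x :: complex assume x: "x \<in> cball 0 r"
    show "(K has_field_derivative deriv P x - deriv P 0) (at x within cball 0 r)"
      using dK x by (simp add: has_field_derivative_at_within)
    have "24 * C * cmod x \<le> 24 * C * r" using x C by simp
    then show "cmod (deriv P x - deriv P 0) \<le> 24 * C * r"
      using K'[of x] x by simp
  qed (use z w in auto)
  show "cmod (K z) \<le> 12 * C * (cmod z)\<^sup>2" if z: "cmod z \<le> r"
  proof -
    have le: "cmod (complex_of_real t * z) \<le> r" if "0 \<le> t" "t \<le> 1" for t
      using that z mult_left_le_one_le[of "cmod z" t] by (simp add: norm_mult)
    have der: "((\<lambda>t. K (of_real t * z)) has_vector_derivative
        (z * (deriv P (of_real t * z) - deriv P 0))) (at t)" if "0 \<le> t" "t \<le> 1" for t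
    proof -
      have "((\<lambda>t. complex_of_real t * z) has_vector_derivative z) (at t)"
        by (auto intro!: derivative_eq_intros)
      from field_vector_diff_chain_at[OF this dK[OF le[OF that]]] show ?thesis
        by (simp add: o_def)
    qed
    \<comment> \<open>The speed of \<open>K\<close> along the radius is at most 24 C |z|^2 t, the
      derivative of the comparison function 12 C |z|^2 t^2.\<close>
    have "cmod (K (of_real 1 * z) - K (of_real 0 * z))
        \<le> 12 * C * (cmod z)\<^sup>2 * 1\<^sup>2 - 12 * C * (cmod z)\<^sup>2 * 0\<^sup>2"
    proof (rule differentiable_bound_general[where f = "\<lambda>t. K (of_real t * z)"
          and \<phi> = "\<lambda>t. 12 * C * (cmod z)\<^sup>2 * t\<^sup>2" and \<phi>' = "\<lambda>t. 24 * C * (cmod z)\<^sup>2 * t"])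
      show "continuous_on {0..1} (\<lambda>t. K (of_real t * z))"
        using der by (intro continuous_at_imp_continuous_on ballI)
          (auto intro: has_vector_derivative_continuous)
      show "((\<lambda>t. 12 * C * (cmod z)\<^sup>2 * t\<^sup>2) has_vector_derivative 24 * C * (cmod z)\<^sup>2 * t) (at t)"
        for t :: real
        unfolding has_real_derivative_iff_has_vector_derivative[symmetric]
        by (auto intro!: derivative_eq_intros)
      fix t :: real assume t: "0 < t" "t < 1"
      show "cmod (z * (deriv P (of_real t * z) - deriv P 0)) \<le> 24 * C * (cmod z)\<^sup>2 * t"
        using mult_left_mono[OF K'[OF le[of t]], of "cmod z"] t
        by (simp add: norm_mult power2_eq_square mult_ac)
    qed (use der in \<open>auto intro!: continuous_intros\<close>)
    then show ?thesis by (simp add: K_def P0)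
  qed
qed

text \<open>This turns a bound on \<open>Re (c * w)\<close> that is uniform over unimodular
  \<open>c\<close> into a bound on \<open>cmod w\<close>.\<close>

lemma exists_unimodular_rotation: "\<exists>c. cmod c = 1 \<and> Re (c * w) = cmod w"
proof (cases "w = 0")
  case False
  then have "cnj w / cmod w * w = of_real (cmod w)"
    by (simp add: complex_norm_square[symmetric] power2_eq_square mult.commute field_simps)
  then show ?thesis
    using False by (intro exI[of _ "cnj w / cmod w"]) (simp add: norm_divide)
qed (auto intro: exI[of _ 1])

theorem theorem3p3:
  fixes k M C :: real and f h g :: "complex \<Rightarrow> complex"
  assumes "0 \<le> k" and "k < 1" and "0 \<le> M" and "k + M < 1"
    and "harmonic_H0 k M f h g"
    and "C > 0" and "\<forall>z\<in>\<D>. cmod (f z) \<le> C"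
  shows "inj_on f (ball 0 (3 * pi * (1 - k - M) / (256 * C)))
    \<and> ball 0 (3 * pi * (1 - k - M)\<^sup>2 / (512 * C))
        \<subseteq> f ` ball 0 (3 * pi * (1 - k - M) / (256 * C))"
proof -

  \<comment> \<open>Normalisation at the origin\<close>
  define L where "L = 1 - k - M"
  define r where "r = 3 * pi * L / (256 * C)"
  have L: "0 < L" "L \<le> 1" using assms by (auto simp: L_def)
  have f: "f z = h z + cnj (g z)" if "cmod z < 1" for z
    using assms(5) that by (simp add: harmonic_H0_def harmonic_H_def)
  have hol: "h holomorphic_on \<D>" "g holomorphic_on \<D>"
    using assms(5) by (auto simp: harmonic_H0_def harmonic_H_def analytic_imp_holomorphic)
  have f0: "f 0 = 0" and g0: "g 0 = 0" and h'0: "deriv h 0 = 1"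
    using assms(5) by (auto simp: harmonic_H0_def)
  have h0: "h 0 = 0" using f[of 0] f0 g0 by simp
  define b where "b = deriv g 0"
  \<comment> \<open>At the origin \<open>deriv h 0 = 1\<close>, so the relation between g' and h'
    reads b = \<omega>(0) + \<psi>(0).\<close>
  have b: "cmod b \<le> k + M"
  proof -
    obtain \<omega> \<psi> where *: "\<forall>z\<in>\<D>. deriv g z = \<omega> z * deriv h z + \<psi> z"
      and sup: "sup_norm \<omega> \<le> ereal k" "sup_norm \<psi> \<le> ereal M"
      using assms(5) by (auto simp: harmonic_H0_def harmonic_H_def)
    have "cmod (\<omega> 0) \<le> k" "cmod (\<psi> 0) \<le> M"
      using sup by (auto simp: sup_norm_def SUP_le_iff)
    moreover have "b = \<omega> 0 + \<psi> 0"
      using * h'0 by (simp add: b_def)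
    ultimately show ?thesis
      using norm_triangle_ineq[of "\<omega> 0" "\<psi> 0"] by simp
  qed

  \<comment> \<open>Analytic functions with real part Re (c f), and the size of the radius\<close>
  define P where "P c z = c * h z + cnj c * g z" for c z
  have P_hol: "P c holomorphic_on ball 0 1" for c
    unfolding P_def using hol by (intro holomorphic_intros)
  have P0: "P c 0 = 0" for c by (simp add: P_def h0 g0)
  have Re_P: "Re (P c z) = Re (c * f z)" if "cmod z < 1" for c z
    using f[OF that] by (simp add: P_def algebra_simps)
  have Re_le: "Re (P c z) \<le> C" if "cmod c = 1" "cmod z < 1" for c z
    using bspec[OF assms(7), of z] that complex_Re_le_cmod[of "c * f z"] Re_P[of z c]
    by (simp add: norm_mult)
  have P'0: "deriv (P c) 0 = c + cnj c * b" for c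
  proof (rule DERIV_imp_deriv)
    have "(h has_field_derivative 1) (at 0)" "(g has_field_derivative b) (at 0)"
      using holomorphic_derivI[OF hol(1), of 0] holomorphic_derivI[OF hol(2), of 0] h'0
      by (auto simp: b_def)
    then show "(P c has_field_derivative c + cnj c * b) (at 0)"
      unfolding P_def by (auto intro!: derivative_eq_intros)
  qed

  \<comment> \<open>The rotations \<open>c = 1\<close> and \<open>c = \<i>\<close> bound |1 + b| and
    |1 - b| by 2C, while these two moduli sum to at least 2. This lower bound on \<open>C\<close> is
    what keeps \<open>r\<close> below 1/10.\<close>
  have C: "1 / 2 \<le> C"
  proof -
    have 1: "cmod (deriv (P 1) 0) \<le> 2 * C" "cmod (deriv (P \<i>) 0) \<le> 2 * C"
      using half_plane_Schwarz(2)[OF P_hol P0 assms(6) Re_le] by auto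
    have "cmod (1 + b) + cmod (1 - b) \<ge> 2"
      using norm_triangle_ineq[of "1 + b" "1 - b"] by simp
    moreover have "cmod (\<i> + cnj \<i> * b) = cmod (1 - b)"
      using norm_mult[of \<i> "1 - b"] by (simp add: algebra_simps)
    ultimately show ?thesis using 1 by (simp add: P'0)
  qed
  \<comment> \<open>Here 24 C r = (9 pi / 32) L, about 0.884 L, and r \<le> 3 pi / 128, about
    0.074.\<close>
  have r: "0 < r" "r \<le> 1 / 10" and Cr: "24 * C * r < L"
  proof -
    show "0 < r" using L assms(6) by (simp add: r_def)
    show "24 * C * r < L"
      using pi_approx L assms(6) by (simp add: r_def field_simps)
    have "3 * pi * L \<le> 3 * pi * 1"
      using L by (intro mult_left_mono) auto
    also have "\<dots> \<le> 128 / 10" using pi_approx by simp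
    also have "\<dots> \<le> 256 * C * (1 / 10)" using C by simp
    finally show "r \<le> 1 / 10"
      using assms(6) by (simp add: r_def field_simps)
  qed

  \<comment> \<open>Deviation of f from its real-linear part at 0\<close>
  have lin: "cmod (w + cnj (b * w)) \<ge> L * cmod w" for w
  proof -
    have "(k + M) * cmod w \<ge> cmod b * cmod w"
      using b by (rule mult_right_mono) simp
    then show ?thesis
      using norm_diff_ineq[of w "cnj (b * w)"] by (simp add: L_def norm_mult algebra_simps)
  qed
  define \<Phi> where "\<Phi> z = f z - (z + cnj (b * z))" for z
  \<comment> \<open>Conjugation preserves real parts, so the linear part of \<open>f\<close>,
    multiplied by \<open>c\<close>, has the same real part as \<open>(c + cnj c * b) * z\<close>,
    the linear part of \<open>P c\<close>.\<close>
  have Re_\<Phi>: "Re (c * \<Phi> z) = Re (P c z - deriv (P c) 0 * z)" if "cmod z < 1" for c z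
    unfolding \<Phi>_def right_diff_distrib minus_complex.sel Re_P[OF that, symmetric] P'0
    by (simp add: algebra_simps)
  have \<Phi>_Lip: "cmod (\<Phi> z - \<Phi> w) \<le> 24 * C * r * cmod (z - w)"
    if z: "cmod z \<le> r" and w: "cmod w \<le> r" for z w
  proof -
    \<comment> \<open>The rotation depends on \<open>z\<close> and \<open>w\<close>, but the
      Lipschitz constant for \<open>P c\<close> does not depend on \<open>c\<close>.\<close>
    obtain c where c: "cmod c = 1" "Re (c * (\<Phi> z - \<Phi> w)) = cmod (\<Phi> z - \<Phi> w)"
      using exists_unimodular_rotation by blast
    have "Re (c * (\<Phi> z - \<Phi> w)) =
        Re ((P c z - deriv (P c) 0 * z) - (P c w - deriv (P c) 0 * w))"
      using Re_\<Phi>[of z c] Re_\<Phi>[of w c] z w r by (simp add: right_diff_distrib)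
    also have "\<dots> \<le> 24 * C * r * cmod (z - w)"
      by (rule order_trans[OF complex_Re_le_cmod
          half_plane_linear_deviation(1)[OF P_hol P0 assms(6) Re_le[OF c(1)] r(2) z w]])
    finally show ?thesis unfolding c(2) .
  qed
  have \<Phi>_quad: "cmod (\<Phi> z) \<le> 12 * C * (cmod z)\<^sup>2" if z: "cmod z \<le> r" for z
  proof -
    obtain c where c: "cmod c = 1" "Re (c * \<Phi> z) = cmod (\<Phi> z)"
      using exists_unimodular_rotation by blast
    have "Re (c * \<Phi> z) = Re (P c z - deriv (P c) 0 * z)"
      using Re_\<Phi>[of z c] z r by simp
    also have "\<dots> \<le> 12 * C * (cmod z)\<^sup>2"
      by (rule order_trans[OF complex_Re_le_cmod
          half_plane_linear_deviation(2)[OF P_hol P0 assms(6) Re_le[OF c(1)] r(2) z]])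
    finally show ?thesis unfolding c(2) .
  qed

  \<comment> \<open>Univalence and covering\<close>
  have inj: "inj_on f (ball 0 r)"
  proof (rule inj_onI, rule ccontr)
    fix z w assume zw: "z \<in> ball 0 r" "w \<in> ball 0 r" "f z = f w" "z \<noteq> w"
    \<comment> \<open>If \<open>f z = f w\<close>, the deviation must cancel the linear part, which
      stretches \<open>z - w\<close> by at least \<open>L\<close>; its Lipschitz constant 24 C r is
      smaller than \<open>L\<close>.\<close>
    have "\<Phi> z - \<Phi> w = - ((z - w) + cnj (b * (z - w)))"
      using zw(3) by (simp add: \<Phi>_def algebra_simps)
    then have "L * cmod (z - w) \<le> cmod (\<Phi> z - \<Phi> w)"
      using lin[of "z - w"] by (simp add: norm_minus_cancel del: minus_add_distrib)
    also have "\<dots> \<le> 24 * C * r * cmod (z - w)"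
      using \<Phi>_Lip zw by simp
    also have "\<dots> < L * cmod (z - w)"
      using Cr zw by simp
    finally show False by simp
  qed
  have cont: "continuous_on (cball 0 r) f"
  proof -
    have sub: "cball 0 r \<subseteq> \<D>" using r by auto
    have "continuous_on (cball 0 r) (\<lambda>z. h z + cnj (g z))"
      using hol[THEN holomorphic_on_imp_continuous_on, THEN continuous_on_subset, OF sub]
      by (intro continuous_intros)
    then show ?thesis
      using sub f by (subst continuous_on_cong[OF refl]) auto
  qed
  \<comment> \<open>Two facts suffice: the image of the open disk is open, by invariance of domain
    for the continuous injective \<open>f\<close>, and \<open>f\<close> stays at distance at least L
    r / 2 from \<open>f 0\<close> on the bounding circle.\<close>
  have "ball (f 0) (L * r / 2) \<subseteq> f ` ball 0 r"
  proof (rule ball_subset_open_map_image)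
    show "continuous_on (closure (ball 0 r)) f"
      using cont r by simp
    show "open (f ` interior (ball 0 r))"
      using inj continuous_on_subset[OF cont ball_subset_cball]
      by (simp add: invariance_of_domain)
    fix z :: complex assume "z \<in> frontier (ball 0 r)"
    then have z: "cmod z = r" using r by (simp add: frontier_ball)
    \<comment> \<open>Half of 24 C r < L, times \<open>r\<close>: on the circle the deviation takes
      away at most half of the lower bound L r for the linear part.\<close>
    have "12 * C * r\<^sup>2 \<le> L / 2 * r"
      using Cr r by (simp add: power2_eq_square)
    moreover have "f z = (z + cnj (b * z)) + \<Phi> z"
      by (simp add: \<Phi>_def)
    ultimately show "L * r / 2 \<le> cmod (f z - f 0)"
      using norm_diff_ineq[of "z + cnj (b * z)" "\<Phi> z"] lin[of z] \<Phi>_quad[of z] z f0 by simp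
  qed (use r L in auto)
  moreover have "L * r / 2 = 3 * pi * L\<^sup>2 / (512 * C)"
    by (simp add: r_def power2_eq_square)
  ultimately show ?thesis
    using inj unfolding f0 L_def[symmetric] r_def[symmetric] by simp
qed

end
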